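(* Let $\mathcal{H}$ and $\mathcal{K}$ be Hilbert spaces, $X\in\mathcal{B}(\mathcal{H},\mathcal{K})$, and for $T\in\mathcal{B}(\mathcal{K})$, $V\in\mathcal{B}(\mathcal{H})$ let $$R(X)=\begin{bmatrix} T & X\\ 0 & V\end{bmatrix}\in\mathcal{B}(\mathcal{K}\oplus\mathcal{H}).$$ (a) Suppose $V$ is an isometry and $T$ is a right invertible contraction. Then $R(X)$ is similar to a contraction if and only if $X=A+F$ with $A,F\in\mathcal{B}(\mathcal{H},\mathcal{K})$ satisfying $$\sup_{n\ge0}\Big\|\sum_{j=0}^{n}T^jAV^{*\,j+1}\Big\|<\infty\quad\text{and}\quad FV=0.$$ (b) Suppose $T$ is a coisometry (i.e. $TT^*=I$) and $V$ is a left invertible contraction. Then $R(X)$ is similar to a contraction if and only if $X=A+F$ with $A,F\in\mathcal{B}(\mathcal{H},\mathcal{K})$ satisfying $$\sup_{n\ge0}\Big\|\sum_{j=0}^{n}T^{*\,j+1}AV^{j}\Big\|<\infty\quad\text{and}\quad TF=0.$$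
   Context: An operator $R$ on a Hilbert space $\mathcal{E}$ is similar to a contraction if there is an invertible $L\in\mathcal{B}(\mathcal{E})$ with $\|L^{-1}RL\|\le1$. *)

theory Defs
  imports "HOL-Analysis.Analysis"
begin

text \<open>A complex Hilbert space is modelled as a real Hilbert space
(type class real_inner + complete_space) together with an orthogonal complex
structure J (multiplication by the imaginary unit): J is bounded linear,
J (J x) = - x and J preserves the real inner product.  The complex inner
product is then inner x y + i * inner x (J y), and complex-linear bounded
operators are exactly the bounded real-linear operators commuting with J.\<close>

definition cplx_structure :: "('a::real_inner \<Rightarrow>\<^sub>L 'a) \<Rightarrow> bool" where
  "cplx_structure J \<longleftrightarrow> (\<forall>x. J (J x) = - x) \<and> (\<forall>x y. inner (J x) (J y) = inner x y)"

definition cbounded :: "('a::real_normed_vector \<Rightarrow>\<^sub>L 'a) \<Rightarrow> ('b::real_normed_vector \<Rightarrow>\<^sub>L 'b)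
    \<Rightarrow> ('a \<Rightarrow>\<^sub>L 'b) \<Rightarrow> bool" where
  "cbounded JH JK X \<longleftrightarrow> X o\<^sub>L JH = JK o\<^sub>L X"

definition hadj :: "('a::real_inner \<Rightarrow>\<^sub>L 'b::real_inner) \<Rightarrow> ('b \<Rightarrow>\<^sub>L 'a)" where
  "hadj X = (THE Y. \<forall>x y. inner (blinfun_apply X x) y = inner x (blinfun_apply Y y))"

definition opow :: "('a::real_normed_vector \<Rightarrow>\<^sub>L 'a) \<Rightarrow> nat \<Rightarrow> ('a \<Rightarrow>\<^sub>L 'a)" where
  "opow T n = ((\<lambda>S. T o\<^sub>L S) ^^ n) id_blinfun"

text \<open>Block operator matrix [T X; 0 V] on K \<oplus> H (product type, Hilbert direct sum norm).\<close>
definition block_op :: "('k::real_normed_vector \<Rightarrow>\<^sub>L 'k) \<Rightarrow> ('h::real_normed_vector \<Rightarrow>\<^sub>L 'k)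
    \<Rightarrow> ('h \<Rightarrow>\<^sub>L 'h) \<Rightarrow> (('k \<times> 'h) \<Rightarrow>\<^sub>L ('k \<times> 'h))" where
  "block_op T X V = Blinfun (\<lambda>(k, h). (T k + X h, V h))"

definition sum_J :: "('k::real_normed_vector \<Rightarrow>\<^sub>L 'k) \<Rightarrow> ('h::real_normed_vector \<Rightarrow>\<^sub>L 'h)
    \<Rightarrow> (('k \<times> 'h) \<Rightarrow>\<^sub>L ('k \<times> 'h))" where
  "sum_J JK JH = Blinfun (\<lambda>(k, h). (JK k, JH h))"

definition similar_to_contraction :: "('e::real_normed_vector \<Rightarrow>\<^sub>L 'e) \<Rightarrow> ('e \<Rightarrow>\<^sub>L 'e) \<Rightarrow> bool" where
  "similar_to_contraction J R \<longleftrightarrow>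
     (\<exists>L M. cbounded J J L \<and> cbounded J J M \<and> L o\<^sub>L M = id_blinfun \<and> M o\<^sub>L L = id_blinfun
        \<and> norm (M o\<^sub>L R o\<^sub>L L) \<le> 1)"

definition isometry_op :: "('a::real_normed_vector \<Rightarrow>\<^sub>L 'b::real_normed_vector) \<Rightarrow> bool" where
  "isometry_op V \<longleftrightarrow> (\<forall>x. norm (V x) = norm x)"

definition right_invertible_op :: "('a::real_normed_vector \<Rightarrow>\<^sub>L 'a) \<Rightarrow> ('a \<Rightarrow>\<^sub>L 'a) \<Rightarrow> bool" where
  "right_invertible_op J T \<longleftrightarrow> (\<exists>S. cbounded J J S \<and> T o\<^sub>L S = id_blinfun)"

definition left_invertible_op :: "('a::real_normed_vector \<Rightarrow>\<^sub>L 'a) \<Rightarrow> ('a \<Rightarrow>\<^sub>L 'a) \<Rightarrow> bool" where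
  "left_invertible_op J T \<longleftrightarrow> (\<exists>S. cbounded J J S \<and> S o\<^sub>L T = id_blinfun)"

end

theory Submission
  imports Defs
begin

text \<open>
  In both parts each side of the equivalence says that the operator equation \<open>X = Z V - T Z\<close> has a
  bounded solution \<open>Z\<close>.

  A solution makes \<open>R(X)\<close> similar to \<open>T \<oplus> V\<close>.  Conversely, if \<open>C = L\<inverse> R(X) L\<close> is a contraction and
  \<open>V\<close> is an isometry, then \<open>P = snd L\<close> satisfies \<open>P C = V P\<close>, and a right inverse \<open>\<Phi>\<close> of \<open>P\<close> with
  \<open>\<Phi> V = C \<Phi>\<close> is the same as a solution \<open>Z\<close> (isometries are projective among operators similar to
  contractions).  Its adjoint \<open>Y\<close> is a left inverse of \<open>P*\<close> with \<open>V* Y = Y C*\<close>; it is obtained as a Banach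
  limit of left inverses \<open>Y\<^sub>n\<close> of \<open>P*\<close>, uniformly bounded, with \<open>V* Y\<^sub>n\<^sub>+\<^sub>1 = Y\<^sub>n C*\<close>.

  In (a) the sums \<open>Y\<^sub>n = \<Sum>j\<le>n. T\<^sup>j A V*\<^sup>j\<^sup>+\<^sup>1\<close> satisfy \<open>Y\<^sub>n\<^sub>+\<^sub>1 V = A + T Y\<^sub>n\<close>, so a weak Banach limit solves
  the equation for \<open>A\<close>, while \<open>- S F\<close> solves it for \<open>F\<close> when \<open>T S = I\<close> and \<open>F V = 0\<close>.  Conversely, given
  \<open>Z\<close>, put \<open>W = Z V V*\<close> and \<open>A = Z V - T W\<close>: the sums telescope to \<open>W - T\<^sup>n\<^sup>+\<^sup>1 W V*\<^sup>n\<^sup>+\<^sup>1\<close>.  Part (b) is dual.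
\<close>

section \<open>Banach limits\<close>

text \<open>The laws are imposed on bounded sequences, so that a plain function type suffices. Shift
  invariance is what later turns a recursion between consecutive operators into an equation for
  their limit.\<close>

definition banach_limit :: "((nat \<Rightarrow> real) \<Rightarrow> real) \<Rightarrow> bool" where
  "banach_limit \<phi> \<longleftrightarrow>
     (\<forall>s t. Bseq s \<longrightarrow> Bseq t \<longrightarrow> \<phi> (\<lambda>n. s n + t n) = \<phi> s + \<phi> t) \<and>
     (\<forall>s c. Bseq s \<longrightarrow> \<phi> (\<lambda>n. c * s n) = c * \<phi> s) \<and>
     (\<forall>s B. (\<forall>n. \<bar>s n\<bar> \<le> B) \<longrightarrow> \<bar>\<phi> s\<bar> \<le> B) \<and>
     (\<forall>s. Bseq s \<longrightarrow> \<phi> (\<lambda>n. s (Suc n)) = \<phi> s) \<and>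
     (\<forall>c. \<phi> (\<lambda>n. c) = c)"

text \<open>A cluster point, in the compact product of the intervals \<open>[- sup \<bar>s\<bar>, sup \<bar>s\<bar>]\<close>, of the
  sequence of Cesaro means, each regarded as a functional of \<open>s\<close>.\<close>

lemma banach_limit_exists: "\<exists>\<phi>. banach_limit \<phi>"
proof -
  \<comment> \<open>The value 0 at unbounded sequences keeps every \<open>m n\<close> inside
    \<open>PiE UNIV S\<close>, whose factor there is \<open>{0}\<close>.\<close>
  define m :: "nat \<Rightarrow> (nat \<Rightarrow> real) \<Rightarrow> real" where
    "m n s = (if Bseq s then (\<Sum>k<Suc n. s k) / real (Suc n) else 0)" for n s
  have m_bound: "\<bar>m n s\<bar> \<le> B" if "\<And>n. \<bar>s n\<bar> \<le> B" for n s B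
  proof -
    have "\<bar>\<Sum>k<Suc n. s k\<bar> \<le> (\<Sum>k<Suc n. B)"
      by (intro order_trans[OF sum_abs] sum_mono that)
    moreover have "0 \<le> B" using that[of 0] by linarith
    ultimately show ?thesis by (simp add: m_def field_simps)
  qed
  define b where "b s = (SOME B. \<forall>n. \<bar>s n\<bar> \<le> (B::real))" for s :: "nat \<Rightarrow> real"
  have b: "\<bar>s n\<bar> \<le> b s" if "Bseq s" for s n
  proof -
    have "\<exists>B. \<forall>n. \<bar>s n\<bar> \<le> B" using that by (auto simp: Bseq_def)
    from someI_ex[OF this] show ?thesis by (simp add: b_def)
  qed
  define S where "S s = (if Bseq s then cball 0 (b s) else {0::real})" for s
  define F where "F = filtermap m sequentially"
  have "compactin (product_topology (\<lambda>i. euclidean) UNIV) (PiE UNIV S)"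
    by (auto simp: compactin_PiE S_def)
  then have cpt: "compact (PiE UNIV S)"
    by (simp add: euclidean_product_topology)
  have inS: "m n s \<in> S s" for n s
    using m_bound[of s "b s" n] b by (auto simp: S_def m_def)
  have "eventually (\<lambda>f. f \<in> PiE UNIV S) F"
    unfolding F_def eventually_filtermap using inS by (intro always_eventually) auto
  moreover have "F \<noteq> bot" by (simp add: F_def filtermap_bot_iff)
  ultimately obtain \<phi> where \<phi>: "inf (nhds \<phi>) F \<noteq> bot"
    using cpt unfolding compact_filter by blast
  \<comment> \<open>\<open>G\<close> is proper and refines both \<open>nhds \<phi>\<close> and
    \<open>F\<close>. So evaluations converge to those of \<open>\<phi>\<close> along
    \<open>G\<close>, and identities or limits valid for the means pass to
    \<open>\<phi>\<close>.\<close>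
  define G where "G = inf (nhds \<phi>) F"
  have G: "G \<noteq> bot" using \<phi> by (simp add: G_def)
  have lim: "((\<lambda>f. f s) \<longlongrightarrow> \<phi> s) G" for s
  proof -
    have "((\<lambda>f. f s) \<longlongrightarrow> \<phi> s) (nhds \<phi>)"
    proof (rule topological_tendstoI)
      fix U :: "real set" assume U: "open U" "\<phi> s \<in> U"
      have "open ((\<lambda>f. f s) -` U)"
        using U(1) by (rule open_vimage) simp
      then show "\<forall>\<^sub>F f in nhds \<phi>. f s \<in> U"
        using U(2) unfolding eventually_nhds by (intro exI[of _ "(\<lambda>f. f s) -` U"]) auto
    qed
    then show ?thesis
      by (rule filterlim_mono) (auto simp: G_def)
  qed
  have evG: "eventually P G" if "\<And>n. P (m n)" for P
  proof -
    have "eventually P F" using that by (auto simp: F_def eventually_filtermap)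
    then show ?thesis by (rule filter_leD[rotated]) (simp add: G_def)
  qed
  have tG: "(h \<longlongrightarrow> l) G" if "(\<lambda>n. h (m n)) \<longlonglongrightarrow> l" for h and l :: real
  proof -
    have "(h \<longlongrightarrow> l) F" using that by (simp add: F_def filterlim_filtermap)
    then show ?thesis by (rule filterlim_mono) (auto simp: G_def)
  qed
  have eqG: "u = v" if "(h \<longlongrightarrow> u) G" "(h' \<longlongrightarrow> v) G" "\<And>n. h (m n) = h' (m n)" for h h' and u v :: real
  proof -
    have "(h' \<longlongrightarrow> u) G"
      using that(1) evG[of "\<lambda>f. h f = h' f"] that(3) by (auto intro: Lim_transform_eventually)
    with that(2) show ?thesis using G tendsto_unique by blast
  qed
  have "banach_limit \<phi>"
    unfolding banach_limit_def
  proof (intro conjI allI impI)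
    fix s t :: "nat \<Rightarrow> real" assume st: "Bseq s" "Bseq t"
    have "Bseq (\<lambda>n. s n + t n)"
      by (rule BseqI'[of _ "b s + b t"]) (use b[OF st(1)] b[OF st(2)] in \<open>fastforce intro: order_trans[OF abs_triangle_ineq] add_mono\<close>)
    with st show "\<phi> (\<lambda>n. s n + t n) = \<phi> s + \<phi> t"
      by (intro eqG[OF lim tendsto_add[OF lim lim]]) (simp add: m_def sum.distrib add_divide_distrib)
  next
    fix s :: "nat \<Rightarrow> real" and c assume s: "Bseq s"
    then have "Bseq (\<lambda>n. c * s n)" by (intro Bseq_mult) auto
    with s show "\<phi> (\<lambda>n. c * s n) = c * \<phi> s"
      by (intro eqG[OF lim tendsto_mult[OF tendsto_const lim]])
        (simp add: m_def sum_distrib_left distrib_left)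
  next
    fix s :: "nat \<Rightarrow> real" and B assume "\<forall>n. \<bar>s n\<bar> \<le> B"
    then show "\<bar>\<phi> s\<bar> \<le> B"
      using m_bound evG[of "\<lambda>f. \<bar>f s\<bar> \<le> B"]
      by (intro tendsto_upperbound[OF tendsto_rabs[OF lim[of s]] _ G]) auto
  next
    fix s :: "nat \<Rightarrow> real" assume s: "Bseq s"
    have s': "Bseq (\<lambda>n. s (Suc n))" using s by (simp add: Bseq_Suc_iff)
    \<comment> \<open>Shifting changes the sum by two boundary terms only, which division makes
      negligible.\<close>
    have "m n (\<lambda>n. s (Suc n)) - m n s = (s (Suc n) - s 0) / real (Suc n)" for n
    proof -
      have "(\<Sum>k<Suc n. s (Suc k)) = (\<Sum>k<Suc n. s k) + s (Suc n) - s 0"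
        by (induction n) auto
      then show ?thesis
        using s s' by (simp add: m_def diff_divide_distrib add_divide_distrib del: sum.lessThan_Suc)
    qed
    moreover have "(\<lambda>n. (s (Suc n) - s 0) / real (Suc n)) \<longlonglongrightarrow> 0"
    proof (rule Lim_null_comparison)
      show "(\<lambda>n. (2 * b s) * inverse (real (Suc n))) \<longlonglongrightarrow> 0"
        by (intro tendsto_mult_right_zero LIMSEQ_inverse_real_of_nat)
      have "\<bar>s (Suc n) - s 0\<bar> \<le> 2 * b s" for n
        using b[OF s, of "Suc n"] b[OF s, of 0] by linarith
      then show "\<forall>\<^sub>F n in sequentially. norm ((s (Suc n) - s 0) / real (Suc n)) \<le> 2 * b s * inverse (real (Suc n))"
        by (intro always_eventually allI) (simp add: divide_simps)
    qed
    ultimately have "((\<lambda>f. f (\<lambda>n. s (Suc n)) - f s) \<longlongrightarrow> 0) G"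
      by (intro tG) simp
    moreover have "((\<lambda>f. f (\<lambda>n. s (Suc n)) - f s) \<longlongrightarrow> \<phi> (\<lambda>n. s (Suc n)) - \<phi> s) G"
      by (intro tendsto_diff lim)
    ultimately have "\<phi> (\<lambda>n. s (Suc n)) - \<phi> s = 0" using G tendsto_unique by blast
    then show "\<phi> (\<lambda>n. s (Suc n)) = \<phi> s" by simp
  next
    fix c :: real
    show "\<phi> (\<lambda>n. c) = c"
      by (intro eqG[OF lim tendsto_const]) (simp add: m_def field_simps)
  qed
  then show ?thesis by blast
qed

definition blim :: "(nat \<Rightarrow> real) \<Rightarrow> real" where
  "blim = (SOME \<phi>. banach_limit \<phi>)"

lemma banach_limit_blim: "banach_limit blim"
  unfolding blim_def using someI_ex[OF banach_limit_exists] .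

lemma blim_add: "Bseq s \<Longrightarrow> Bseq t \<Longrightarrow> blim (\<lambda>n. s n + t n) = blim s + blim t"
  and blim_mult: "Bseq s \<Longrightarrow> blim (\<lambda>n. c * s n) = c * blim s"
  and blim_bound: "(\<And>n. \<bar>s n\<bar> \<le> B) \<Longrightarrow> \<bar>blim s\<bar> \<le> B"
  and blim_Suc: "Bseq s \<Longrightarrow> blim (\<lambda>n. s (Suc n)) = blim s"
  and blim_const: "blim (\<lambda>n. c) = c"
  using banach_limit_blim by (auto simp: banach_limit_def)

section \<open>Adjoints\<close>

text \<open>The representing vector minimises \<open>(norm x)^2 - 2 * f x\<close>: the parallelogram
  law makes a minimising sequence Cauchy, and the first variation vanishes at its limit.\<close>

lemma riesz_representation:
  fixes f :: "'a::{real_inner, complete_space} \<Rightarrow> real"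
  assumes "bounded_linear f"
  shows "\<exists>z. \<forall>x. f x = inner z x"
proof -
  interpret f: bounded_linear f by fact
  obtain K where K: "\<And>x. norm (f x) \<le> norm x * K" using f.bounded by blast
  define J where "J x = (norm x)\<^sup>2 - 2 * f x" for x
  have lb: "- K\<^sup>2 \<le> J x" for x
  proof -
    have "0 \<le> (norm x - K)\<^sup>2" by simp
    then have "2 * (norm x * K) \<le> (norm x)\<^sup>2 + K\<^sup>2" by (simp add: power2_diff algebra_simps)
    moreover have "f x \<le> norm x * K" using K[of x] by simp
    ultimately show ?thesis by (simp add: J_def)
  qed
  define \<mu> where "\<mu> = (INF x. J x)"
  have bdd: "bdd_below (range J)" using lb by (intro bdd_belowI) auto
  have \<mu>: "\<mu> \<le> J x" for x unfolding \<mu>_def using bdd by (intro cINF_lower) auto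
  have "\<exists>x. J x < \<mu> + inverse (real (Suc n))" for n
    using cINF_less_iff[of UNIV J "\<mu> + inverse (real (Suc n))"] bdd by (auto simp: \<mu>_def)
  then obtain x where x: "\<And>n. J (x n) < \<mu> + inverse (real (Suc n))" by metis
  have par: "(norm (u - v))\<^sup>2 \<le> 2 * (J u - \<mu>) + 2 * (J v - \<mu>)" for u v
  proof -
    have "(norm (u - v))\<^sup>2 = 2 * J u + 2 * J v - 4 * J ((1/2) *\<^sub>R (u + v))"
      unfolding J_def power2_norm_eq_inner f.scaleR f.add
      by (simp add: inner_simps inner_commute algebra_simps)
    moreover have "4 * \<mu> \<le> 4 * J ((1/2) *\<^sub>R (u + v))" using \<mu> by simp
    ultimately show ?thesis by (simp add: right_diff_distrib)
  qed
  have "Cauchy x"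
  proof (rule metric_CauchyI)
    fix e :: real assume e: "0 < e"
    obtain N where N: "inverse (real (Suc N)) < e\<^sup>2 / 4"
      using reals_Archimedean[of "e\<^sup>2/4"] e by auto
    have small: "J (x n) - \<mu> < e\<^sup>2 / 4" if "n \<ge> N" for n
    proof -
      have "inverse (real (Suc n)) \<le> inverse (real (Suc N))" using that by (simp add: field_simps)
      then show ?thesis using x[of n] N by linarith
    qed
    show "\<exists>M. \<forall>m\<ge>M. \<forall>n\<ge>M. dist (x m) (x n) < e"
    proof (intro exI allI impI)
      fix m n assume mn: "m \<ge> N" "n \<ge> N"
      have "(norm (x m - x n))\<^sup>2 < e\<^sup>2"
        using par[of "x m" "x n"] small[OF mn(1)] small[OF mn(2)] by argo
      then show "dist (x m) (x n) < e" using e by (auto simp: dist_norm intro: power_less_imp_less_base)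
    qed
  qed
  then obtain z where z: "x \<longlonglongrightarrow> z" using Cauchy_convergent convergentD by blast
  have "(\<lambda>n. J (x n)) \<longlonglongrightarrow> J z" unfolding J_def by (intro tendsto_intros f.tendsto z)
  moreover have "(\<lambda>n. \<mu> + inverse (real (Suc n))) \<longlonglongrightarrow> \<mu> + 0"
    by (intro tendsto_intros LIMSEQ_inverse_real_of_nat)
  ultimately have "J z \<le> \<mu> + 0"
    by (rule LIMSEQ_le) (use x in \<open>auto intro: less_imp_le\<close>)
  then have min: "J z \<le> J y" for y using \<mu>[of y] by simp
  have "f y = inner z y" for y
  proof -
    define d where "d = inner z y - f y"
    have J: "J (z + t *\<^sub>R y) = J z + 2 * t * d + t\<^sup>2 * (norm y)\<^sup>2" for t
      unfolding J_def d_def power2_norm_eq_inner f.scaleR f.add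
      by (simp add: inner_simps inner_commute algebra_simps power2_eq_square)
    have pos: "0 \<le> 2 * t * d + t\<^sup>2 * (norm y)\<^sup>2" for t using min[of "z + t *\<^sub>R y"] J[of t] by simp
    \<comment> \<open>Putting \<open>t = - d / k\<close> into \<open>pos\<close> will give
      \<open>0 \<le> - d^2 / k\<close>; the summand 1 keeps \<open>k\<close> positive for
      \<open>y = 0\<close>.\<close>
    define k where "k = (norm y)\<^sup>2 + 1"
    have k: "k > 0" "(norm y)\<^sup>2 < k" by (auto simp: k_def add_nonneg_pos)
    have "0 \<le> 2 * (- d / k) * d + (- d / k)\<^sup>2 * (norm y)\<^sup>2" by (rule pos)
    also have "\<dots> \<le> 2 * (- d / k) * d + (- d / k)\<^sup>2 * k"
      using k by (intro add_left_mono mult_left_mono) auto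
    also have "\<dots> = - d\<^sup>2 / k" using k by (simp add: power2_eq_square field_simps)
    finally have "d\<^sup>2 \<le> 0" using k by (simp add: field_simps)
    then show ?thesis by (simp add: d_def)
  qed
  then show ?thesis by blast
qed

text \<open>Uniqueness of representing vectors makes them depend linearly on \<open>y\<close>. This
  is the source of both adjoints and weak operator limits.\<close>

lemma riesz_representation_bilinear:
  fixes B :: "'b::real_normed_vector \<Rightarrow> 'a::{real_inner, complete_space} \<Rightarrow> real"
  assumes B: "bounded_bilinear B"
  shows "\<exists>Y :: 'b \<Rightarrow>\<^sub>L 'a. \<forall>y x. B y x = inner (Y y) x"
proof -
  interpret bounded_bilinear B by fact
  have "\<exists>z. \<forall>x. B y x = inner z x" for y
    by (rule riesz_representation[OF bounded_linear_right])
  then obtain g where g: "\<And>y x. B y x = inner (g y) x" by metis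
  obtain K where "0 \<le> K" and K: "\<And>y x. norm (B y x) \<le> norm y * norm x * K"
    using nonneg_bounded by blast
  have "bounded_linear g"
  proof (rule bounded_linear_intro)
    show "g (x + y) = g x + g y" for x y
      by (simp add: vector_eq_rdot[symmetric] inner_add_left add_left flip: g)
    show "g (r *\<^sub>R x) = r *\<^sub>R g x" for r x
      by (simp add: vector_eq_rdot[symmetric] scaleR_left flip: g)
    show "norm (g x) \<le> norm x * K" for x
    proof (cases "g x = 0")
      case True
      then show ?thesis using \<open>0 \<le> K\<close> by simp
    next
      case False
      have "norm (g x) * norm (g x) \<le> norm x * norm (g x) * K"
        using K[of x "g x"] g[of x "g x"] by (simp add: dot_square_norm power2_eq_square)
      then show ?thesis using False by (simp add: mult.assoc mult.left_commute)
    qed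
  qed
  then show ?thesis using g by (intro exI[of _ "Blinfun g"]) (auto simp: bounded_linear_Blinfun_apply)
qed

text \<open>Justifies the definite description in \<open>hadj\<close>, which is used afterwards only
  through this equation.\<close>

lemma inner_hadj_right:
  fixes X :: "'a::{real_inner, complete_space} \<Rightarrow>\<^sub>L 'b::real_inner"
  shows "inner x (hadj X y) = inner (X x) y"
proof -
  have "bounded_bilinear (\<lambda>y x. inner (X x) y)"
    by (rule bounded_bilinear.flip[OF bounded_bilinear.comp1[OF bounded_bilinear_inner blinfun.bounded_linear_right]])
  from riesz_representation_bilinear[OF this]
  obtain Y where Y: "\<And>x y. inner (X x) y = inner x (blinfun_apply Y y)"
    using inner_commute by metis
  have "\<exists>!Y. \<forall>x y. inner (X x) y = inner x (blinfun_apply Y y)"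
  proof (rule ex1I)
    fix Y' :: "'b \<Rightarrow>\<^sub>L 'a" assume "\<forall>x y. inner (X x) y = inner x (blinfun_apply Y' y)"
    then show "Y' = Y" by (intro blinfun_eqI) (metis Y vector_eq_ldot)
  qed (use Y in blast)
  from theI'[OF this, folded hadj_def] show ?thesis by (auto dest: sym)
qed

lemma inner_hadj_left:
  fixes X :: "'a::{real_inner, complete_space} \<Rightarrow>\<^sub>L 'b::real_inner"
  shows "inner (hadj X y) x = inner y (X x)"
  by (simp add: inner_commute[of "hadj X y"] inner_hadj_right inner_commute[of y])

lemma blinfun_eq_innerI:
  fixes A B :: "'a::real_normed_vector \<Rightarrow>\<^sub>L 'b::real_inner"
  assumes "\<And>x y. inner (A x) y = inner (B x) y"
  shows "A = B"
  by (intro blinfun_eqI) (metis assms vector_eq_rdot)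

lemma hadj_hadj:
  fixes X :: "'a::{real_inner, complete_space} \<Rightarrow>\<^sub>L 'b::{real_inner, complete_space}"
  shows "hadj (hadj X) = X"
  by (rule blinfun_eq_innerI) (simp add: inner_hadj_left inner_hadj_right)

lemma hadj_compose:
  fixes A :: "'b::{real_inner, complete_space} \<Rightarrow>\<^sub>L 'c::real_inner"
    and B :: "'a::{real_inner, complete_space} \<Rightarrow>\<^sub>L 'b"
  shows "hadj (A o\<^sub>L B) = hadj B o\<^sub>L hadj A"
  by (rule blinfun_eq_innerI) (simp add: inner_hadj_left)

lemma hadj_diff:
  fixes A B :: "'a::{real_inner, complete_space} \<Rightarrow>\<^sub>L 'b::real_inner"
  shows "hadj (A - B) = hadj A - hadj B"
  by (rule blinfun_eq_innerI)
    (simp add: inner_hadj_left blinfun.diff_left inner_diff_left inner_diff_right)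

lemma hadj_id: "hadj (id_blinfun :: 'a::{real_inner, complete_space} \<Rightarrow>\<^sub>L 'a) = id_blinfun"
  by (rule blinfun_eq_innerI) (simp add: inner_hadj_left)

text \<open>One factor \<open>norm (X x)\<close> cancels after Cauchy-Schwarz in
  \<open>norm (X x) * norm (X x) = inner x (hadj X (X x))\<close>.\<close>

lemma norm_le_if_norm_hadj_le:
  fixes X :: "'a::{real_inner, complete_space} \<Rightarrow>\<^sub>L 'b::real_inner"
  assumes "norm (hadj X) \<le> c"
  shows "norm X \<le> c"
proof (rule norm_blinfun_bound)
  show c: "0 \<le> c" using assms norm_ge_zero order_trans by blast
  fix x
  have "norm (X x) * norm (X x) = inner x (hadj X (X x))"
    by (simp add: inner_hadj_right dot_square_norm power2_eq_square)
  also have "\<dots> \<le> norm x * norm (hadj X (X x))" by (rule norm_cauchy_schwarz)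
  also have "\<dots> \<le> norm x * (c * norm (X x))"
    by (intro mult_left_mono order_trans[OF norm_blinfun] mult_right_mono assms) auto
  finally show "norm (X x) \<le> c * norm x"
    by (cases "X x = 0") (use c in \<open>simp_all add: mult_ac\<close>)
qed

lemma norm_hadj_le:
  fixes X :: "'a::{real_inner, complete_space} \<Rightarrow>\<^sub>L 'b::{real_inner, complete_space}"
  shows "norm X \<le> c \<Longrightarrow> norm (hadj X) \<le> c"
  using norm_le_if_norm_hadj_le[of "hadj X" c] by (simp add: hadj_hadj)

text \<open>By polarization, preserving norms means preserving inner products.\<close>

lemma isometry_op_iff_hadj:
  fixes V :: "'a::{real_inner, complete_space} \<Rightarrow>\<^sub>L 'b::real_inner"
  shows "isometry_op V \<longleftrightarrow> hadj V o\<^sub>L V = id_blinfun"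
proof
  assume V: "isometry_op V"
  have sq: "inner (V x) (V x) = inner x x" for x
    using V by (simp add: isometry_op_def dot_square_norm)
  show "hadj V o\<^sub>L V = id_blinfun"
  proof (rule blinfun_eq_innerI)
    fix x y
    have "inner (V (x + y)) (V (x + y)) = inner (x + y) (x + y)" by (rule sq)
    then have "inner (V x) (V y) = inner x y"
      by (simp add: blinfun.add_right inner_simps sq inner_commute)
    then show "inner ((hadj V o\<^sub>L V) x) y = inner (id_blinfun x) y"
      by (simp add: inner_hadj_left)
  qed
next
  assume V: "hadj V o\<^sub>L V = id_blinfun"
  have "inner (V x) (V x) = inner x x" for x
    using inner_hadj_left[of V "V x" x] blinfun_apply_blinfun_compose[of "hadj V" V x] by (simp add: V)
  then show "isometry_op V" by (simp add: isometry_op_def norm_eq_sqrt_inner)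
qed

section \<open>Weak Banach limits of operators\<close>

text \<open>The Banach limit is taken in every matrix coefficient. As a relation it lets an equation
  between sequences pass to the limit side by side, closed by \<open>wblim_unique\<close>.\<close>

definition wblim :: "(nat \<Rightarrow> 'a::real_normed_vector \<Rightarrow>\<^sub>L 'b::real_inner) \<Rightarrow> ('a \<Rightarrow>\<^sub>L 'b) \<Rightarrow> bool" where
  "wblim Z L \<longleftrightarrow> (\<forall>x y. inner (L x) y = blim (\<lambda>n. inner (Z n x) y))"

lemma abs_inner_blinfun_le: "norm A \<le> C \<Longrightarrow> \<bar>inner (blinfun_apply A x) y\<bar> \<le> C * norm x * norm y"
  by (meson Cauchy_Schwarz_ineq2 mult_right_mono norm_blinfun norm_ge_zero order_trans)

lemma Bseq_inner_blinfun:
  assumes "\<And>n. norm (Z n) \<le> C"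
  shows "Bseq (\<lambda>n. inner (blinfun_apply (Z n) x) y)"
  by (rule BseqI'[of _ "C * norm x * norm y"]) (simp add: abs_inner_blinfun_le assms)

lemma wblim_exists:
  fixes Z :: "nat \<Rightarrow> 'a::real_normed_vector \<Rightarrow>\<^sub>L 'b::{real_inner, complete_space}"
  assumes Z: "\<And>n. norm (Z n) \<le> C"
  shows "\<exists>L. wblim Z L"
proof -
  note B = Bseq_inner_blinfun[of Z C, OF Z]
  have "bounded_bilinear (\<lambda>x y. blim (\<lambda>n. inner (Z n x) y))"
  proof
    show "\<exists>K. \<forall>a b. norm (blim (\<lambda>n. inner (Z n a) b)) \<le> norm a * norm b * K"
      using abs_inner_blinfun_le[OF Z] by (intro exI[of _ C] allI) (auto intro!: blim_bound simp: mult_ac)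
  qed (simp_all add: blinfun.add_right blinfun.scaleR_right inner_add_left inner_add_right blim_add blim_mult B)
  from riesz_representation_bilinear[OF this] show ?thesis unfolding wblim_def by metis
qed

lemma wblim_unique: "wblim Z L \<Longrightarrow> wblim Z L' \<Longrightarrow> L = L'"
  by (rule blinfun_eq_innerI) (simp add: wblim_def)

lemma wblim_const: "wblim (\<lambda>n. A) A"
  by (simp add: wblim_def blim_const)

lemma wblim_add:
  assumes "wblim Y K" "wblim Z L" "\<And>n. norm (Y n) \<le> B" "\<And>n. norm (Z n) \<le> C"
  shows "wblim (\<lambda>n. Y n + Z n) (K + L)"
  using assms Bseq_inner_blinfun[of Y B] Bseq_inner_blinfun[of Z C]
  by (simp add: wblim_def blinfun.add_left inner_add_left blim_add)

lemma wblim_Suc: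
  assumes "wblim Z L" "\<And>n. norm (Z n) \<le> C"
  shows "wblim (\<lambda>n. Z (Suc n)) L"
  unfolding wblim_def
proof (intro allI)
  fix x y
  show "inner (L x) y = blim (\<lambda>n. inner (Z (Suc n) x) y)"
    using assms(1) blim_Suc[OF Bseq_inner_blinfun[of Z C x y, OF assms(2)]] by (simp add: wblim_def)
qed

lemma wblim_compose_right: "wblim Z L \<Longrightarrow> wblim (\<lambda>n. Z n o\<^sub>L Q) (L o\<^sub>L Q)"
  by (simp add: wblim_def)

text \<open>Moving \<open>P\<close> across the inner product turns coefficients of
  \<open>P o\<^sub>L Z n\<close> into coefficients of \<open>Z n\<close>.\<close>

lemma wblim_compose_left:
  fixes P :: "'b::{real_inner, complete_space} \<Rightarrow>\<^sub>L 'c::real_inner"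
  assumes "wblim Z L"
  shows "wblim (\<lambda>n. P o\<^sub>L Z n) (P o\<^sub>L L)"
  using assms by (simp add: wblim_def flip: inner_hadj_right)

section \<open>Lifting through an isometry\<close>

text \<open>The Lax-Milgram theorem: for small \<open>t\<close> the map
  \<open>x - t *\<^sub>R (A x - y)\<close> is a contraction whose fixed point solves
  \<open>A x = y\<close>.\<close>

lemma coercive_imp_invertible:
  fixes A :: "'a::{real_inner, complete_space} \<Rightarrow>\<^sub>L 'a"
  assumes e: "0 < e" and A: "\<And>x. e * (norm x)\<^sup>2 \<le> inner (A x) x"
  shows "\<exists>B. A o\<^sub>L B = id_blinfun \<and> B o\<^sub>L A = id_blinfun"
proof -
  have lower: "e * norm x \<le> norm (A x)" for x
  proof (cases "x = 0")
    case False
    have "e * norm x * norm x \<le> norm (A x) * norm x"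
      using A[of x] norm_cauchy_schwarz[of "A x" x] by (simp add: power2_eq_square mult.assoc)
    then show ?thesis using False by simp
  qed simp
  \<comment> \<open>Adding \<open>e\<close> to \<open>norm A\<close> ensures \<open>0 < N\<close>
    and \<open>e \<le> N\<close>, so that \<open>c\<close> below lies in [0, 1). The chosen
    \<open>t\<close> minimises \<open>1 - 2 * t * e + t^2 * N^2\<close>.\<close>
  define N where "N = e + norm A"
  have N: "0 < N" "e \<le> N" "norm A \<le> N" using e by (auto simp: N_def add_pos_nonneg)
  define t where "t = e / N\<^sup>2"
  have t: "0 < t" using e N by (simp add: t_def)
  define c where "c = sqrt (1 - e\<^sup>2 / N\<^sup>2)"
  have e_le: "e\<^sup>2 / N\<^sup>2 \<le> 1" using e N by (simp add: power_mono)
  then have c: "0 \<le> c" "c < 1" using e N by (auto simp: c_def)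
  have contr: "norm (x - t *\<^sub>R A x) \<le> c * norm x" for x
  proof -
    have "(norm (A x))\<^sup>2 \<le> (N * norm x)\<^sup>2"
      using norm_blinfun[of A x] N
      by (intro power_mono order_trans[OF norm_blinfun] mult_right_mono) auto
    then have "t\<^sup>2 * (norm (A x))\<^sup>2 \<le> t\<^sup>2 * (N\<^sup>2 * (norm x)\<^sup>2)"
      by (intro mult_left_mono) (auto simp: power_mult_distrib)
    moreover have "2 * t * (e * (norm x)\<^sup>2) \<le> 2 * t * inner (A x) x"
      using A[of x] t by (intro mult_left_mono) auto
    moreover have "(norm (x - t *\<^sub>R A x))\<^sup>2 = (norm x)\<^sup>2 - 2 * t * inner (A x) x + t\<^sup>2 * (norm (A x))\<^sup>2"
      unfolding power2_norm_eq_inner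
      by (simp add: inner_diff_left inner_diff_right inner_commute algebra_simps power2_eq_square)
    ultimately have "(norm (x - t *\<^sub>R A x))\<^sup>2
        \<le> (norm x)\<^sup>2 - 2 * t * (e * (norm x)\<^sup>2) + t\<^sup>2 * (N\<^sup>2 * (norm x)\<^sup>2)" by linarith
    also have "\<dots> = (1 - 2 * t * e + t\<^sup>2 * N\<^sup>2) * (norm x)\<^sup>2" by (simp add: algebra_simps)
    also have "1 - 2 * t * e + t\<^sup>2 * N\<^sup>2 = 1 - e\<^sup>2 / N\<^sup>2"
      using N by (simp add: t_def field_simps power2_eq_square)
    also have "\<dots> = c\<^sup>2" using e_le by (simp add: c_def)
    finally have "(norm (x - t *\<^sub>R A x))\<^sup>2 \<le> (c * norm x)\<^sup>2" by (simp add: power_mult_distrib)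
    then show ?thesis using c by (auto intro: power2_le_imp_le)
  qed
  have "\<exists>x. A x = y" for y
  proof -
    have "\<exists>!x. x - t *\<^sub>R (A x - y) = x"
    proof (rule banach_fix_type[OF c], intro allI)
      fix u v
      have "u - t *\<^sub>R (A u - y) - (v - t *\<^sub>R (A v - y)) = (u - v) - t *\<^sub>R A (u - v)"
        by (simp add: blinfun.diff_right algebra_simps)
      then show "dist (u - t *\<^sub>R (A u - y)) (v - t *\<^sub>R (A v - y)) \<le> c * dist u v"
        using contr[of "u - v"] by (simp only: dist_norm)
    qed
    then show ?thesis using t by auto
  qed
  then obtain g where g: "\<And>y. A (g y) = y" by metis
  have inj: "x = y" if "A x = A y" for x y
    using lower[of "x - y"] that e by (simp add: blinfun.diff_right mult_le_0_iff)
  have "bounded_linear g"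
  proof (rule bounded_linear_intro)
    show "g (x + y) = g x + g y" for x y by (rule inj) (simp add: g blinfun.add_right)
    show "g (r *\<^sub>R x) = r *\<^sub>R g x" for r x by (rule inj) (simp add: g blinfun.scaleR_right)
    show "norm (g x) \<le> norm x * (1 / e)" for x using lower[of "g x"] e by (simp add: g field_simps)
  qed
  then have "A o\<^sub>L Blinfun g = id_blinfun" "Blinfun g o\<^sub>L A = id_blinfun"
    using inj[OF g] by (auto intro!: blinfun_eqI simp: bounded_linear_Blinfun_apply g)
  then show ?thesis by blast
qed

text \<open>The condition \<open>hadj V o\<^sub>L Y' = G\<close> forces \<open>Y' = V o\<^sub>L G + D\<close> with \<open>D\<close> mapping into the kernel of
  \<open>hadj V\<close>, and \<open>norm Y' \<le> d\<close> then means that \<open>norm (D x)\<close> is dominated by the seminorm of the form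
  \<open>Q = d\<^sup>2 - hadj G o\<^sub>L G\<close>.  As \<open>D\<close> is prescribed, with this bound, on the range of \<open>hadj P\<close>, it extends
  along the \<open>Q\<close>-orthogonal projection; the strict inequality \<open>c < d\<close> makes \<open>Q\<close> coercive.\<close>

lemma lifting_step:
  fixes C :: "'e::{real_inner, complete_space} \<Rightarrow>\<^sub>L 'e"
    and P :: "'e \<Rightarrow>\<^sub>L 'h::{real_inner, complete_space}"
  assumes C: "norm C \<le> 1" and V: "hadj V o\<^sub>L V = id_blinfun" and PC: "P o\<^sub>L C = V o\<^sub>L P"
    and YP: "Y o\<^sub>L hadj P = id_blinfun" and Y: "norm Y \<le> c" and cd: "c < d"
  shows "\<exists>Y'. norm Y' \<le> d \<and> Y' o\<^sub>L hadj P = id_blinfun \<and> hadj V o\<^sub>L Y' = Y o\<^sub>L hadj C"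
proof -
  have c0: "0 \<le> c" using Y norm_ge_zero order_trans by blast
  have VV: "hadj V (V x) = x" for x
    using arg_cong[OF V, of "\<lambda>A. blinfun_apply A x"] by simp
  have YPx: "Y (hadj P x) = x" for x
    using arg_cong[OF YP, of "\<lambda>A. blinfun_apply A x"] by simp
  have "hadj C o\<^sub>L hadj P = hadj P o\<^sub>L hadj V"
    using arg_cong[OF PC, of hadj] by (simp add: hadj_compose)
  then have CP: "hadj C (hadj P x) = hadj P (hadj V x)" for x
    using arg_cong[of _ _ "\<lambda>A. blinfun_apply A x"] by (metis blinfun_apply_blinfun_compose)
  define G where "G = Y o\<^sub>L hadj C"
  have "norm Y * norm (hadj C) \<le> c * 1"
    using Y norm_hadj_le[OF C] by (intro mult_mono) (auto simp: c0)
  then have "norm G \<le> c" unfolding G_def using norm_blinfun_compose[of Y "hadj C"] by simp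
  then have G: "norm (G x) \<le> c * norm x" for x
    using norm_blinfun[of G x] by (meson mult_right_mono norm_ge_zero order_trans)
  define Q where "Q = d\<^sup>2 *\<^sub>R id_blinfun - (hadj G o\<^sub>L G)"
  have Q: "inner (Q x) y = d\<^sup>2 * inner x y - inner (G x) (G y)" for x y
    by (simp add: Q_def blinfun.diff_left blinfun.scaleR_left inner_diff_left inner_hadj_left)
  define k where "k = d\<^sup>2 - c\<^sup>2"
  have k: "0 < k" using cd c0 by (simp add: k_def power_strict_mono)
  have Q_lower: "k * (norm x)\<^sup>2 \<le> inner (Q x) x" for x
  proof -
    have "(norm (G x))\<^sup>2 \<le> (c * norm x)\<^sup>2" by (intro power_mono G) simp
    then show ?thesis by (simp add: Q k_def power_mult_distrib left_diff_distrib dot_square_norm)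
  qed
  \<comment> \<open>Having the bounded left inverse \<open>Y\<close>, the operator
    \<open>hadj P\<close> is bounded below.\<close>
  have P_lower: "(norm h)\<^sup>2 \<le> d\<^sup>2 * (norm (hadj P h))\<^sup>2" for h
  proof -
    have "norm h \<le> norm Y * norm (hadj P h)" using norm_blinfun[of Y "hadj P h"] by (simp add: YPx)
    also have "\<dots> \<le> d * norm (hadj P h)" using Y cd by (intro mult_right_mono) auto
    finally show ?thesis by (metis norm_ge_zero power_mono power_mult_distrib)
  qed
  have d: "0 < d" using cd c0 by simp
  \<comment> \<open>Coercivity of \<open>Q\<close> and the lower bound on \<open>hadj P\<close> make
    this compression coercive; its inverse yields the \<open>Q\<close>-orthogonal projection
    explicitly.\<close>
  have "\<exists>B. (P o\<^sub>L Q o\<^sub>L hadj P) o\<^sub>L B = id_blinfun \<and> B o\<^sub>L (P o\<^sub>L Q o\<^sub>L hadj P) = id_blinfun"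
  proof (rule coercive_imp_invertible)
    show "0 < k / d\<^sup>2" using k d by simp
    fix h
    have "k / d\<^sup>2 * (norm h)\<^sup>2 \<le> k / d\<^sup>2 * (d\<^sup>2 * (norm (hadj P h))\<^sup>2)"
      using k by (intro mult_left_mono P_lower) auto
    also have "\<dots> = k * (norm (hadj P h))\<^sup>2" using d by simp
    also have "\<dots> \<le> inner (Q (hadj P h)) (hadj P h)" by (rule Q_lower)
    finally show "k / d\<^sup>2 * (norm h)\<^sup>2 \<le> inner ((P o\<^sub>L Q o\<^sub>L hadj P) h) h"
      by (simp add: inner_hadj_right)
  qed
  then obtain B where B: "(P o\<^sub>L Q o\<^sub>L hadj P) o\<^sub>L B = id_blinfun" "B o\<^sub>L (P o\<^sub>L Q o\<^sub>L hadj P) = id_blinfun"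
    by blast
  have B1: "P (Q (hadj P (B x))) = x" for x
    using arg_cong[OF B(1), of "\<lambda>A. blinfun_apply A x"] by simp
  have B2: "B (P (Q (hadj P x))) = x" for x
    using arg_cong[OF B(2), of "\<lambda>A. blinfun_apply A x"] by simp
  \<comment> \<open>\<open>hadj P o\<^sub>L S\<close> is the projection onto the range of \<open>hadj P\<close> orthogonal for \<open>\<lambda>x y. inner (Q x) y\<close>.\<close>
  define S where "S = B o\<^sub>L P o\<^sub>L Q"
  \<comment> \<open>The first summand takes values in the range of \<open>V\<close>, the second in
    the kernel of \<open>hadj V\<close>. On the range of \<open>hadj P\<close> they combine to the
    required left inverse, as \<open>G\<close> acts there as \<open>hadj V\<close> and
    \<open>S\<close> as the identity.\<close>
  define Y' where "Y' = (V o\<^sub>L G) + ((id_blinfun - (V o\<^sub>L hadj V)) o\<^sub>L S)"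
  have Y'_apply: "Y' x = V (G x) + (S x - V (hadj V (S x)))" for x
    by (simp add: Y'_def blinfun.add_left blinfun.diff_left)
  have GP: "G (hadj P x) = hadj V x" for x by (simp add: G_def CP YPx)
  have "norm Y' \<le> d"
  proof (rule norm_blinfun_bound)
    show "0 \<le> d" using d by simp
    fix x
    define s where "s = S x"
    define p where "p = hadj P s"
    have "inner (Q (x - p)) p = 0"
      by (simp add: p_def inner_hadj_right blinfun.diff_right s_def S_def B1)
    then have orth: "inner (Q x) p = inner (Q p) p" by (simp add: blinfun.diff_right inner_diff_left)
    have sym: "inner (Q p) x = inner (Q x) p" by (simp only: Q) (simp add: inner_commute)
    have "0 \<le> inner (Q (x - p)) (x - p)"
      using Q_lower[of "x - p"] k by (meson less_imp_le mult_nonneg_nonneg order_trans zero_le_power2)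
    then have qp: "inner (Q p) p \<le> inner (Q x) x"
      by (simp add: blinfun.diff_right inner_diff_left inner_diff_right sym orth)
    have "(norm (Y' x))\<^sup>2 = (norm (G x))\<^sup>2 + ((norm s)\<^sup>2 - (norm (hadj V s))\<^sup>2)"
      unfolding power2_norm_eq_inner Y'_apply s_def[symmetric]
      by (simp add: inner_add_left inner_add_right inner_diff_left inner_diff_right VV
          blinfun.add_right blinfun.diff_right inner_hadj_right[of _ V, symmetric] inner_hadj_left[of V, symmetric])
    \<comment> \<open>Since \<open>G p = hadj V s\<close>, this is \<open>P_lower\<close> for
      \<open>s\<close>; the \<open>Q\<close>-projection \<open>p\<close> of \<open>x\<close> then
      has no larger \<open>Q\<close>-form than \<open>x\<close>.\<close>
    also have "\<dots> \<le> (norm (G x))\<^sup>2 + inner (Q p) p"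
      using P_lower[of s] by (simp add: Q p_def GP dot_square_norm)
    also have "\<dots> \<le> (norm (G x))\<^sup>2 + inner (Q x) x" using qp by simp
    also have "\<dots> = (d * norm x)\<^sup>2" by (simp add: Q dot_square_norm power_mult_distrib)
    finally show "norm (Y' x) \<le> d * norm x" using d by (auto intro: power2_le_imp_le)
  qed
  moreover have "Y' o\<^sub>L hadj P = id_blinfun"
    by (rule blinfun_eqI) (simp add: Y'_apply GP S_def B2)
  moreover have "hadj V o\<^sub>L Y' = Y o\<^sub>L hadj C"
    by (rule blinfun_eqI) (simp add: Y'_apply blinfun.add_right blinfun.diff_right VV G_def)
  ultimately show ?thesis by blast
qed

text \<open>Each lifting step changes the left inverse, so no single \<open>Y n\<close> need
  intertwine; shift invariance of the limit identifies the two sides.\<close>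

lemma isometry_lifting:
  fixes C :: "'e::{real_inner, complete_space} \<Rightarrow>\<^sub>L 'e"
    and P :: "'e \<Rightarrow>\<^sub>L 'h::{real_inner, complete_space}"
  assumes C: "norm C \<le> 1" and V: "hadj V o\<^sub>L V = id_blinfun" and PC: "P o\<^sub>L C = V o\<^sub>L P"
    and PR: "P o\<^sub>L R = id_blinfun"
  shows "\<exists>\<Phi>. \<Phi> o\<^sub>L V = C o\<^sub>L \<Phi> \<and> P o\<^sub>L \<Phi> = id_blinfun"
proof -
  have RP: "hadj R (hadj P h) = h" for h
    using arg_cong[OF arg_cong[OF PR, of hadj], of "\<lambda>A. blinfun_apply A h"]
    by (simp add: hadj_compose hadj_id)
  define r where "r = norm (hadj R) + 1"
  have YP0: "hadj R o\<^sub>L hadj P = id_blinfun" by (rule blinfun_eqI) (simp add: RP)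
  \<comment> \<open>The bounds increase strictly, as \<open>lifting_step\<close> demands, yet stay
    below \<open>r\<close>; \<open>c 0\<close> is exactly \<open>norm (hadj R)\<close>.\<close>
  define c where "c n = r - inverse (real (Suc n))" for n
  have "\<exists>Y. \<forall>n. (norm (Y n) \<le> c n \<and> Y n o\<^sub>L hadj P = id_blinfun) \<and> hadj V o\<^sub>L Y (Suc n) = Y n o\<^sub>L hadj C"
  proof (rule dependent_nat_choice)
    show "\<exists>Y. norm Y \<le> c 0 \<and> Y o\<^sub>L hadj P = id_blinfun"
      using YP0 by (intro exI[of _ "hadj R"]) (simp add: c_def r_def)
    fix Y n assume "norm Y \<le> c n \<and> Y o\<^sub>L hadj P = id_blinfun"
    moreover have "c n < c (Suc n)" by (simp add: c_def field_simps)
    ultimately show "\<exists>Y'. (norm Y' \<le> c (Suc n) \<and> Y' o\<^sub>L hadj P = id_blinfun) \<and> hadj V o\<^sub>L Y' = Y o\<^sub>L hadj C"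
      using lifting_step[OF C V PC] by blast
  qed
  then obtain Y where Yn: "\<And>n. norm (Y n) \<le> c n" and YP: "\<And>n. Y n o\<^sub>L hadj P = id_blinfun"
    and YC: "\<And>n. hadj V o\<^sub>L Y (Suc n) = Y n o\<^sub>L hadj C" by blast
  have Y: "norm (Y n) \<le> r" for n
    using Yn[of n] by (rule order_trans) (simp add: c_def)
  from wblim_exists[of Y r, OF Y] obtain L where L: "wblim Y L" by blast
  have "wblim (\<lambda>n. Y n o\<^sub>L hadj P) (L o\<^sub>L hadj P)" by (rule wblim_compose_right[OF L])
  then have LP: "L o\<^sub>L hadj P = id_blinfun" unfolding YP using wblim_const wblim_unique by blast
  have "wblim (\<lambda>n. hadj V o\<^sub>L Y (Suc n)) (hadj V o\<^sub>L L)"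
    by (intro wblim_compose_left wblim_Suc[OF L, of r] Y)
  then have LC: "hadj V o\<^sub>L L = L o\<^sub>L hadj C"
    unfolding YC using wblim_compose_right[OF L] wblim_unique by blast
  show ?thesis
    using arg_cong[OF LP, of hadj] arg_cong[OF LC, of hadj]
    by (intro exI[of _ "hadj L"]) (simp add: hadj_compose hadj_hadj hadj_id)
qed

section \<open>Powers of operators\<close>

interpretation blinfun_compose: bounded_bilinear "(o\<^sub>L)"
  by (rule bounded_bilinear_blinfun_compose)

lemma blinfun_compose_assoc: "(A o\<^sub>L B) o\<^sub>L C = A o\<^sub>L (B o\<^sub>L C)"
  by (rule blinfun_eqI) simp

lemma blinfun_compose_id [simp]: "A o\<^sub>L id_blinfun = A" "id_blinfun o\<^sub>L A = A"
  by (rule blinfun_eqI; simp)+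

lemma opow_0 [simp]: "opow T 0 = id_blinfun"
  by (simp add: opow_def)

lemma opow_Suc: "opow T (Suc n) = T o\<^sub>L opow T n"
  by (simp add: opow_def)

lemma opow_Suc_right: "opow T (Suc n) = opow T n o\<^sub>L T"
  by (induction n) (simp_all add: opow_Suc flip: blinfun_compose_assoc)

lemma norm_opow_le_1:
  assumes "norm T \<le> 1"
  shows "norm (opow T n) \<le> 1"
proof (induction n)
  case (Suc n)
  have "norm T * norm (opow T n) \<le> 1 * 1" using assms Suc by (intro mult_mono) auto
  then show ?case using norm_blinfun_compose[of T "opow T n"] by (simp add: opow_Suc)
qed (simp add: norm_blinfun_id_le)

lemma norm_compose3_le:
  assumes "norm P \<le> 1" "norm Q \<le> 1"
  shows "norm (P o\<^sub>L W o\<^sub>L Q) \<le> norm W"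
proof -
  have "norm (P o\<^sub>L W o\<^sub>L Q) \<le> norm (P o\<^sub>L W) * norm Q" by (rule norm_blinfun_compose)
  also have "\<dots> \<le> norm (P o\<^sub>L W) * 1" using assms by (intro mult_left_mono) auto
  also have "\<dots> \<le> norm P * norm W" using norm_blinfun_compose[of P W] by simp
  also have "\<dots> \<le> 1 * norm W" using assms by (intro mult_right_mono) auto
  finally show ?thesis by simp
qed

lemma blinfun_compose_applyD: "A o\<^sub>L B = D \<Longrightarrow> A (B x) = D x"
  by (simp flip: blinfun_apply_blinfun_compose)

section \<open>Complex structures and block operators\<close>

lemma cbounded_iff: "cbounded JH JK X \<longleftrightarrow> (\<forall>x. X (JH x) = JK (X x))"
  unfolding cbounded_def by (metis blinfun_apply_blinfun_compose blinfun_eqI)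

lemma cbounded_diff: "cbounded J1 J2 A \<Longrightarrow> cbounded J1 J2 B \<Longrightarrow> cbounded J1 J2 (A - B)"
  by (simp add: cbounded_iff blinfun.diff_left blinfun.diff_right)

lemma cplx_structure_skew:
  assumes "cplx_structure J"
  shows "inner (J x) y = - inner x (J y)"
proof -
  have "inner (J x) (J (J y)) = inner x (J y)" "J (J y) = - y"
    using assms unfolding cplx_structure_def by blast+
  then show ?thesis by simp
qed

text \<open>Both complex structures are skew-adjoint, so the two signs cancel.\<close>

lemma cbounded_hadj:
  fixes V :: "'a::{real_inner, complete_space} \<Rightarrow>\<^sub>L 'b::real_inner"
  assumes "cplx_structure J1" "cplx_structure J2" "cbounded J1 J2 V"
  shows "cbounded J2 J1 (hadj V)"
  unfolding cbounded_def
  by (rule blinfun_eq_innerI)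
    (use assms(3) in \<open>simp add: inner_hadj_left cplx_structure_skew[OF assms(1)]
      cplx_structure_skew[OF assms(2)] cbounded_iff\<close>)

lemma block_op_apply [simp]: "block_op T X V (k, h) = (T k + X h, V h)"
proof -
  have "bounded_linear (\<lambda>p. (T (fst p) + X (snd p), V (snd p)))"
    by (intro bounded_linear_intros)
  then show ?thesis by (simp add: block_op_def split_def bounded_linear_Blinfun_apply)
qed

lemma sum_J_apply [simp]: "sum_J JK JH (k, h) = (JK k, JH h)"
proof -
  have "bounded_linear (\<lambda>p. (JK (fst p), JH (snd p)))"
    by (intro bounded_linear_intros)
  then show ?thesis by (simp add: sum_J_def split_def bounded_linear_Blinfun_apply)
qed

text \<open>The adjoint is lower triangular, so its first coordinate evolves by
  \<open>hadj T\<close> alone.\<close>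

lemma hadj_block_op:
  fixes T :: "'k::{real_inner, complete_space} \<Rightarrow>\<^sub>L 'k" and V :: "'h::{real_inner, complete_space} \<Rightarrow>\<^sub>L 'h"
  shows "hadj (block_op T X V) (k, h) = (hadj T k, hadj X k + hadj V h)"
proof -
  have "inner (hadj (block_op T X V) (k, h)) p = inner (hadj T k, hadj X k + hadj V h) p" for p
    by (cases p) (simp add: inner_hadj_left inner_add_right inner_add_left)
  then show ?thesis using vector_eq_rdot by blast
qed

section \<open>The equation \<open>X = Z V - T Z\<close>\<close>

text \<open>Conjugation by the shear sending \<open>(k, h)\<close> to \<open>(k + Z h, h)\<close>
  removes the corner and leaves the direct sum of \<open>T\<close> and \<open>V\<close>.\<close>

lemma similar_to_contraction_block_op:
  assumes Z: "cbounded JH JK Z" and X: "X = (Z o\<^sub>L V) - (T o\<^sub>L Z)"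
    and T: "norm T \<le> 1" and V: "norm V \<le> 1"
  shows "similar_to_contraction (sum_J JK JH) (block_op T X V)"
proof -
  have lin: "bounded_linear (\<lambda>p. (fst p + Y (snd p), snd p))" for Y :: "'a \<Rightarrow>\<^sub>L 'b"
    by (intro bounded_linear_intros)
  define L where "L = Blinfun (\<lambda>p. (fst p + Z (snd p), snd p))"
  define M where "M = Blinfun (\<lambda>p. (fst p + (- Z) (snd p), snd p))"
  have L: "L (k, h) = (k + Z h, h)" for k h by (simp add: L_def bounded_linear_Blinfun_apply[OF lin])
  have M: "M (k, h) = (k - Z h, h)" for k h
    unfolding M_def bounded_linear_Blinfun_apply[OF lin] by (simp add: blinfun.minus_left)
  have R: "M (block_op T X V (L (k, h))) = (T k, V h)" for k h
    by (simp add: L M X blinfun.add_right blinfun.diff_left)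
  have "norm (M o\<^sub>L block_op T X V o\<^sub>L L) \<le> 1"
  proof (rule norm_blinfun_bound, simp)
    fix p :: "'b \<times> 'a"
    obtain k h where p: "p = (k, h)" by fastforce
    have "norm (T k) \<le> 1 * norm k" "norm (V h) \<le> 1 * norm h"
      by (intro order_trans[OF norm_blinfun] mult_right_mono T V norm_ge_zero)+
    then show "norm ((M o\<^sub>L block_op T X V o\<^sub>L L) p) \<le> 1 * norm p"
      by (simp add: p R norm_Pair power_mono add_mono)
  qed
  moreover have "L o\<^sub>L M = id_blinfun" "M o\<^sub>L L = id_blinfun"
    by (rule blinfun_eqI; clarsimp simp: L M)+
  moreover have "cbounded (sum_J JK JH) (sum_J JK JH) L" "cbounded (sum_J JK JH) (sum_J JK JH) M"
    using Z by (auto simp: cbounded_iff L M blinfun.add_right blinfun.diff_right)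
  ultimately show ?thesis unfolding similar_to_contraction_def by blast
qed

text \<open>Composed with \<open>L\<close>, the lifting is a right inverse of the second projection,
  hence the graph map of some \<open>Z\<close>. It intertwines \<open>V\<close> with the block
  operator, and first coordinates give the equation.\<close>

lemma similar_isometry_imp_intertwined:
  fixes T :: "'k::{real_inner, complete_space} \<Rightarrow>\<^sub>L 'k" and V :: "'h::{real_inner, complete_space} \<Rightarrow>\<^sub>L 'h"
  assumes "similar_to_contraction J (block_op T X V)" and V: "hadj V o\<^sub>L V = id_blinfun"
  shows "\<exists>Z. X = (Z o\<^sub>L V) - (T o\<^sub>L Z)"
proof -
  obtain L M :: "('k \<times> 'h) \<Rightarrow>\<^sub>L ('k \<times> 'h)" where LM: "L o\<^sub>L M = id_blinfun" and C: "norm (M o\<^sub>L block_op T X V o\<^sub>L L) \<le> 1"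
    using assms(1) unfolding similar_to_contraction_def by blast
  have LMx: "L (M x) = x" for x using blinfun_compose_applyD[OF LM] by simp
  define inr :: "'h \<Rightarrow>\<^sub>L ('k \<times> 'h)" where "inr = Blinfun (\<lambda>h. (0, h))"
  have "bounded_linear (\<lambda>h::'h. (0::'k, h))" by (intro bounded_linear_intros)
  then have [simp]: "inr h = (0, h)" for h by (simp add: inr_def bounded_linear_Blinfun_apply)
  have snd_block: "snd (block_op T X V p) = V (snd p)" for p by (cases p) simp
  have "(snd_blinfun o\<^sub>L L) o\<^sub>L (M o\<^sub>L block_op T X V o\<^sub>L L) = V o\<^sub>L (snd_blinfun o\<^sub>L L)"
    by (rule blinfun_eqI) (simp add: LMx snd_block)
  moreover have "(snd_blinfun o\<^sub>L L) o\<^sub>L (M o\<^sub>L inr) = id_blinfun" by (rule blinfun_eqI) (simp add: LMx)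
  ultimately obtain \<Phi> where \<Phi>: "\<Phi> o\<^sub>L V = (M o\<^sub>L block_op T X V o\<^sub>L L) o\<^sub>L \<Phi>" "(snd_blinfun o\<^sub>L L) o\<^sub>L \<Phi> = id_blinfun"
    using isometry_lifting[OF C V] by blast
  define Z where "Z = fst_blinfun o\<^sub>L L o\<^sub>L \<Phi>"
  have "snd (L (\<Phi> h)) = h" for h using blinfun_compose_applyD[OF \<Phi>(2), of h] by simp
  then have graph: "L (\<Phi> h) = (Z h, h)" for h by (simp add: Z_def prod_eq_iff)
  have "X h = ((Z o\<^sub>L V) - (T o\<^sub>L Z)) h" for h
  proof -
    have "L (\<Phi> (V h)) = block_op T X V (L (\<Phi> h))"
      using blinfun_compose_applyD[OF \<Phi>(1), of h] by (simp add: LMx)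
    then show ?thesis by (simp add: graph blinfun.diff_left)
  qed
  then show ?thesis by (intro exI[of _ Z] blinfun_eqI)
qed

text \<open>The dual argument: \<open>hadj T\<close> is an isometry and the adjoint block operator
  has the coordinates in swapped roles. Taking adjoints back costs a sign, so the solution is
  \<open>- hadj Z\<close>.\<close>

lemma similar_coisometry_imp_intertwined:
  fixes T :: "'k::{real_inner, complete_space} \<Rightarrow>\<^sub>L 'k" and V :: "'h::{real_inner, complete_space} \<Rightarrow>\<^sub>L 'h"
  assumes "similar_to_contraction J (block_op T X V)" and T: "T o\<^sub>L hadj T = id_blinfun"
  shows "\<exists>Z. X = (Z o\<^sub>L V) - (T o\<^sub>L Z)"
proof -
  obtain L M :: "('k \<times> 'h) \<Rightarrow>\<^sub>L ('k \<times> 'h)" where LM: "L o\<^sub>L M = id_blinfun" and C: "norm (M o\<^sub>L block_op T X V o\<^sub>L L) \<le> 1"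
    using assms(1) unfolding similar_to_contraction_def by blast
  define R where "R = block_op T X V"
  have "hadj M o\<^sub>L hadj L = id_blinfun" using arg_cong[OF LM, of hadj] by (simp add: hadj_compose hadj_id)
  then have MLx: "hadj M (hadj L x) = x" for x using blinfun_compose_applyD by fastforce
  define inl :: "'k \<Rightarrow>\<^sub>L ('k \<times> 'h)" where "inl = Blinfun (\<lambda>k. (k, 0))"
  have "bounded_linear (\<lambda>k::'k. (k, 0::'h))" by (intro bounded_linear_intros)
  then have [simp]: "inl k = (k, 0)" for k by (simp add: inl_def bounded_linear_Blinfun_apply)
  have R: "hadj R (k, h) = (hadj T k, hadj X k + hadj V h)" for k h
    unfolding R_def by (rule hadj_block_op)
  have fst_R: "fst (hadj R p) = hadj T (fst p)" for p by (cases p) (simp add: R)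
  have C': "norm (hadj L o\<^sub>L hadj R o\<^sub>L hadj M) \<le> 1"
    using norm_hadj_le[OF C] by (simp add: hadj_compose R_def blinfun_compose_assoc)
  have "(fst_blinfun o\<^sub>L hadj M) o\<^sub>L (hadj L o\<^sub>L hadj R o\<^sub>L hadj M) = hadj T o\<^sub>L (fst_blinfun o\<^sub>L hadj M)"
    by (rule blinfun_eqI) (simp add: MLx fst_R)
  moreover have "(fst_blinfun o\<^sub>L hadj M) o\<^sub>L (hadj L o\<^sub>L inl) = id_blinfun"
    by (rule blinfun_eqI) (simp add: MLx)
  moreover have "hadj (hadj T) o\<^sub>L hadj T = id_blinfun" using T by (simp add: hadj_hadj)
  ultimately obtain \<Phi> where \<Phi>: "\<Phi> o\<^sub>L hadj T = (hadj L o\<^sub>L hadj R o\<^sub>L hadj M) o\<^sub>L \<Phi>"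
      "(fst_blinfun o\<^sub>L hadj M) o\<^sub>L \<Phi> = id_blinfun"
    using isometry_lifting[OF C'] by blast
  define Z where "Z = snd_blinfun o\<^sub>L hadj M o\<^sub>L \<Phi>"
  have "fst (hadj M (\<Phi> k)) = k" for k using blinfun_compose_applyD[OF \<Phi>(2), of k] by simp
  then have graph: "hadj M (\<Phi> k) = (k, Z k)" for k by (simp add: Z_def prod_eq_iff)
  have "hadj X k = ((Z o\<^sub>L hadj T) - (hadj V o\<^sub>L Z)) k" for k
  proof -
    have "hadj M (\<Phi> (hadj T k)) = hadj R (hadj M (\<Phi> k))"
      using blinfun_compose_applyD[OF \<Phi>(1), of k] by (simp add: MLx)
    then show ?thesis by (simp add: graph R blinfun.diff_left)
  qed
  then have "hadj X = (Z o\<^sub>L hadj T) - (hadj V o\<^sub>L Z)" by (rule blinfun_eqI)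
  then have "X = (T o\<^sub>L hadj Z) - (hadj Z o\<^sub>L V)"
    by (metis hadj_compose hadj_diff hadj_hadj)
  then have "X = ((- hadj Z) o\<^sub>L V) - (T o\<^sub>L (- hadj Z))"
    by (simp add: blinfun_compose.minus_left blinfun_compose.minus_right)
  then show ?thesis by blast
qed

text \<open>The lifting yields a merely real linear \<open>Z\<close>. Conjugating it by the complex
  structures gives another solution, and the average of the two is complex linear.\<close>

lemma intertwined_cbounded:
  fixes X Z :: "'h::real_inner \<Rightarrow>\<^sub>L 'k::real_inner"
  assumes JK: "cplx_structure JK" and JH: "cplx_structure JH"
    and T: "cbounded JK JK T" and V: "cbounded JH JH V" and X: "cbounded JH JK X"
    and Z: "X = (Z o\<^sub>L V) - (T o\<^sub>L Z)"
  shows "\<exists>Z'. cbounded JH JK Z' \<and> X = (Z' o\<^sub>L V) - (T o\<^sub>L Z')"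
proof -
  have JJ: "JK (JK k) = - k" "JH (JH h) = - h" for k h
    using JK JH by (auto simp: cplx_structure_def)
  have comm: "T (JK k) = JK (T k)" "V (JH h) = JH (V h)" "X (JH h) = JK (X h)" for k h
    using T V X by (auto simp: cbounded_iff)
  define Z' where "Z' = (1/2) *\<^sub>R (Z - (JK o\<^sub>L Z o\<^sub>L JH))"
  have Z': "Z' h = (1/2) *\<^sub>R (Z h - JK (Z (JH h)))" for h
    by (simp add: Z'_def blinfun.scaleR_left blinfun.diff_left)
  have Zh: "Z (V h) = X h + T (Z h)" for h by (simp add: Z blinfun.diff_left)
  have "cbounded JH JK Z'"
    by (simp add: cbounded_iff Z' JJ blinfun.scaleR_right blinfun.diff_right blinfun.minus_right)
  moreover have "X h = ((Z' o\<^sub>L V) - (T o\<^sub>L Z')) h" for h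
  proof -
    have "JK (Z (JH (V h))) = JK (Z (V (JH h)))" by (simp add: comm)
    also have "\<dots> = - X h + T (JK (Z (JH h)))" by (simp only: Zh) (simp add: comm JJ blinfun.add_right)
    finally have "JK (Z (JH (V h))) = - X h + T (JK (Z (JH h)))" .
    then show ?thesis
      by (simp add: blinfun.diff_left Z' Zh blinfun.scaleR_right blinfun.diff_right
          scaleR_diff_right scaleR_add_right flip: scaleR_left.add)
  qed
  ultimately show ?thesis by (intro exI[of _ Z'] conjI blinfun_eqI)
qed

section \<open>Bounded sums and solutions of the equation\<close>

text \<open>Right multiplication by \<open>V\<close> cancels one \<open>hadj V\<close> in each
  summand: the term \<open>j = 0\<close> becomes \<open>A\<close>, the others \<open>T\<close> times
  the preceding sum.\<close>

lemma bounded_sum_imp_intertwined_isometry: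
  fixes T :: "'k::{real_inner, complete_space} \<Rightarrow>\<^sub>L 'k" and V :: "'h::{real_inner, complete_space} \<Rightarrow>\<^sub>L 'h"
  assumes V: "hadj V o\<^sub>L V = id_blinfun" and S: "T o\<^sub>L S = id_blinfun"
    and C: "\<And>n. norm (\<Sum>j=0..n. opow T j o\<^sub>L A o\<^sub>L opow (hadj V) (j + 1)) \<le> C" and F: "F o\<^sub>L V = 0"
  shows "\<exists>Z. A + F = (Z o\<^sub>L V) - (T o\<^sub>L Z)"
proof -
  define Y where "Y n = (\<Sum>j=0..n. opow T j o\<^sub>L A o\<^sub>L opow (hadj V) (j + 1))" for n
  have Y: "norm (Y n) \<le> C" for n using C by (simp add: Y_def)
  have V': "opow (hadj V) (Suc j) o\<^sub>L V = opow (hadj V) j" for j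
    by (simp add: opow_Suc_right blinfun_compose_assoc V)
  have summand: "(opow T j o\<^sub>L A o\<^sub>L opow (hadj V) (Suc j)) o\<^sub>L V = opow T j o\<^sub>L A o\<^sub>L opow (hadj V) j" for j
    by (simp add: blinfun_compose_assoc V')
  have rec: "Y (Suc n) o\<^sub>L V = A + (T o\<^sub>L Y n)" for n
  proof (induction n)
    case 0
    show ?case by (simp add: Y_def blinfun_compose.add_left summand)
      (simp add: opow_Suc blinfun_compose_assoc V)
  next
    case (Suc n)
    have "Y (Suc (Suc n)) o\<^sub>L V
        = (Y (Suc n) o\<^sub>L V) + (opow T (Suc (Suc n)) o\<^sub>L A o\<^sub>L opow (hadj V) (Suc (Suc n)))"
      by (simp add: Y_def blinfun_compose.add_left summand)
    also have "\<dots> = A + (T o\<^sub>L Y (Suc n))"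
      by (simp add: Suc) (simp add: Y_def blinfun_compose.add_right opow_Suc[of T] blinfun_compose_assoc)
    finally show ?case .
  qed
  obtain L where L: "wblim Y L" using wblim_exists[of Y C, OF Y] by blast
  have TY: "norm (T o\<^sub>L Y n) \<le> norm T * C" for n
    using norm_blinfun_compose[of T "Y n"] mult_left_mono[OF Y[of n] norm_ge_zero[of T]] by linarith
  have "wblim (\<lambda>n. Y (Suc n) o\<^sub>L V) (L o\<^sub>L V)"
    by (rule wblim_compose_right[OF wblim_Suc[of Y L C, OF L Y]])
  moreover have "wblim (\<lambda>n. A + (T o\<^sub>L Y n)) (A + (T o\<^sub>L L))"
    by (rule wblim_add[of "\<lambda>_. A" A _ _ "norm A" "norm T * C"])
      (simp_all add: wblim_const wblim_compose_left L TY)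
  ultimately have "L o\<^sub>L V = A + (T o\<^sub>L L)" unfolding rec by (rule wblim_unique)
  then have LV: "L (V h) = A h + T (L h)" for h
    using blinfun_compose_applyD[of L V] by (simp add: blinfun.add_left)
  have "A + F = ((L - (S o\<^sub>L F)) o\<^sub>L V) - (T o\<^sub>L (L - (S o\<^sub>L F)))"
    using blinfun_compose_applyD[OF S] blinfun_compose_applyD[OF F]
    by (intro blinfun_eqI) (simp add: blinfun.add_left blinfun.diff_left blinfun.diff_right LV)
  then show ?thesis by blast
qed

text \<open>Here \<open>T\<close> on the left cancels one \<open>hadj T\<close>. The limit satisfies
  \<open>T L = A + L V\<close>, so \<open>- L\<close> solves the equation for \<open>A\<close>,
  while \<open>F S\<close> solves it for \<open>F\<close>.\<close>

lemma bounded_sum_imp_intertwined_coisometry: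
  fixes T :: "'k::{real_inner, complete_space} \<Rightarrow>\<^sub>L 'k" and V :: "'h::{real_inner, complete_space} \<Rightarrow>\<^sub>L 'h"
  assumes T: "T o\<^sub>L hadj T = id_blinfun" and S: "S o\<^sub>L V = id_blinfun"
    and C: "\<And>n. norm (\<Sum>j=0..n. opow (hadj T) (j + 1) o\<^sub>L A o\<^sub>L opow V j) \<le> C" and F: "T o\<^sub>L F = 0"
  shows "\<exists>Z. A + F = (Z o\<^sub>L V) - (T o\<^sub>L Z)"
proof -
  define Y where "Y n = (\<Sum>j=0..n. opow (hadj T) (j + 1) o\<^sub>L A o\<^sub>L opow V j)" for n
  have Y: "norm (Y n) \<le> C" for n using C by (simp add: Y_def)
  have summand: "T o\<^sub>L (opow (hadj T) (Suc j) o\<^sub>L A o\<^sub>L opow V j) = opow (hadj T) j o\<^sub>L A o\<^sub>L opow V j" for j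
    by (simp add: opow_Suc T flip: blinfun_compose_assoc)
  have rec: "T o\<^sub>L Y (Suc n) = A + (Y n o\<^sub>L V)" for n
  proof (induction n)
    case 0
    show ?case by (simp add: Y_def blinfun_compose.add_right summand)
      (simp add: opow_Suc T flip: blinfun_compose_assoc)
  next
    case (Suc n)
    have "T o\<^sub>L Y (Suc (Suc n))
        = (T o\<^sub>L Y (Suc n)) + (opow (hadj T) (Suc (Suc n)) o\<^sub>L A o\<^sub>L opow V (Suc (Suc n)))"
      by (simp add: Y_def blinfun_compose.add_right summand)
    also have "\<dots> = A + (Y (Suc n) o\<^sub>L V)"
      by (simp add: Suc) (simp add: Y_def blinfun_compose.add_left opow_Suc_right[of V] blinfun_compose_assoc)
    finally show ?case .
  qed
  obtain L where L: "wblim Y L" using wblim_exists[of Y C, OF Y] by blast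
  have YV: "norm (Y n o\<^sub>L V) \<le> C * norm V" for n
    using norm_blinfun_compose[of "Y n" V] mult_right_mono[OF Y[of n] norm_ge_zero[of V]] by linarith
  have "wblim (\<lambda>n. T o\<^sub>L Y (Suc n)) (T o\<^sub>L L)"
    by (rule wblim_compose_left[OF wblim_Suc[of Y L C, OF L Y]])
  moreover have "wblim (\<lambda>n. A + (Y n o\<^sub>L V)) (A + (L o\<^sub>L V))"
    by (rule wblim_add[of "\<lambda>_. A" A _ _ "norm A" "C * norm V"])
      (simp_all add: wblim_const wblim_compose_right L YV)
  ultimately have "T o\<^sub>L L = A + (L o\<^sub>L V)" unfolding rec by (rule wblim_unique)
  then have TL: "T (L h) = A h + L (V h)" for h
    using blinfun_compose_applyD[of T L] by (simp add: blinfun.add_left)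
  have "A + F = (((F o\<^sub>L S) - L) o\<^sub>L V) - (T o\<^sub>L ((F o\<^sub>L S) - L))"
    using blinfun_compose_applyD[OF S] blinfun_compose_applyD[OF F]
    by (intro blinfun_eqI) (simp add: blinfun.add_left blinfun.diff_left blinfun.diff_right TL)
  then show ?thesis by blast
qed

text \<open>Because \<open>Z V (hadj V)\<close> is \<open>W\<close>, the sum telescopes, and each of
  the two remaining ends has norm at most \<open>norm W\<close>.\<close>

lemma bounded_sum_hadj_right:
  fixes T :: "'k::{real_inner, complete_space} \<Rightarrow>\<^sub>L 'k" and V :: "'h::{real_inner, complete_space} \<Rightarrow>\<^sub>L 'h"
    and Z :: "'h \<Rightarrow>\<^sub>L 'k"
  assumes T1: "norm T \<le> 1" and V1: "norm V \<le> 1"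
  defines "W \<equiv> Z o\<^sub>L V o\<^sub>L hadj V"
  shows "norm (\<Sum>j=0..n. opow T j o\<^sub>L ((Z o\<^sub>L V) - (T o\<^sub>L W)) o\<^sub>L opow (hadj V) (j + 1)) \<le> 2 * norm W"
proof -
  have summand: "opow T j o\<^sub>L ((Z o\<^sub>L V) - (T o\<^sub>L W)) o\<^sub>L opow (hadj V) (j + 1)
      = (opow T j o\<^sub>L W o\<^sub>L opow (hadj V) j) - (opow T (Suc j) o\<^sub>L W o\<^sub>L opow (hadj V) (Suc j))" for j
    unfolding W_def
    by (simp add: blinfun_compose.diff_left blinfun_compose.diff_right opow_Suc_right[of T] opow_Suc[of "hadj V"]
        blinfun_compose_assoc)
  have "(\<Sum>j=0..n. opow T j o\<^sub>L ((Z o\<^sub>L V) - (T o\<^sub>L W)) o\<^sub>L opow (hadj V) (j + 1))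
      = W - (opow T (Suc n) o\<^sub>L W o\<^sub>L opow (hadj V) (Suc n))"
    unfolding summand by (induction n) simp_all
  moreover have "norm (opow T (Suc n) o\<^sub>L W o\<^sub>L opow (hadj V) (Suc n)) \<le> norm W"
    by (intro norm_compose3_le norm_opow_le_1 T1 norm_hadj_le V1)
  ultimately show ?thesis
    using norm_triangle_ineq4[of W "opow T (Suc n) o\<^sub>L W o\<^sub>L opow (hadj V) (Suc n)"] by simp
qed

text \<open>The same telescoping, with \<open>hadj T\<close> absorbing \<open>T Z\<close> into
  \<open>W\<close>; the surviving ends carry opposite signs to before.\<close>

lemma bounded_sum_hadj_left:
  fixes T :: "'k::{real_inner, complete_space} \<Rightarrow>\<^sub>L 'k" and V :: "'h::{real_inner, complete_space} \<Rightarrow>\<^sub>L 'h"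
    and Z :: "'h \<Rightarrow>\<^sub>L 'k"
  assumes T1: "norm T \<le> 1" and V1: "norm V \<le> 1"
  defines "W \<equiv> hadj T o\<^sub>L T o\<^sub>L Z"
  shows "norm (\<Sum>j=0..n. opow (hadj T) (j + 1) o\<^sub>L ((W o\<^sub>L V) - (T o\<^sub>L Z)) o\<^sub>L opow V j) \<le> 2 * norm W"
proof -
  have summand: "opow (hadj T) (j + 1) o\<^sub>L ((W o\<^sub>L V) - (T o\<^sub>L Z)) o\<^sub>L opow V j
      = (opow (hadj T) (Suc j) o\<^sub>L W o\<^sub>L opow V (Suc j)) - (opow (hadj T) j o\<^sub>L W o\<^sub>L opow V j)" for j
    unfolding W_def
    by (simp add: blinfun_compose.diff_left blinfun_compose.diff_right opow_Suc_right[of "hadj T"] opow_Suc[of V]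
        blinfun_compose_assoc)
  have "(\<Sum>j=0..n. opow (hadj T) (j + 1) o\<^sub>L ((W o\<^sub>L V) - (T o\<^sub>L Z)) o\<^sub>L opow V j)
      = (opow (hadj T) (Suc n) o\<^sub>L W o\<^sub>L opow V (Suc n)) - W"
    unfolding summand by (induction n) simp_all
  moreover have "norm (opow (hadj T) (Suc n) o\<^sub>L W o\<^sub>L opow V (Suc n)) \<le> norm W"
    by (intro norm_compose3_le norm_opow_le_1 T1 norm_hadj_le V1)
  ultimately show ?thesis
    using norm_triangle_ineq4[of "opow (hadj T) (Suc n) o\<^sub>L W o\<^sub>L opow V (Suc n)" W] by simp
qed

lemma norm_isometry_op_le_1: "isometry_op V \<Longrightarrow> norm V \<le> 1"
  by (rule norm_blinfun_bound) (simp_all add: isometry_op_def)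

theorem theorem2p4:
  fixes JK :: "'k::{real_inner, complete_space} \<Rightarrow>\<^sub>L 'k"
    and JH :: "'h::{real_inner, complete_space} \<Rightarrow>\<^sub>L 'h"
    and T :: "'k \<Rightarrow>\<^sub>L 'k" and V :: "'h \<Rightarrow>\<^sub>L 'h" and X :: "'h \<Rightarrow>\<^sub>L 'k"
  assumes JK: "cplx_structure JK" and JH: "cplx_structure JH"
    and T: "cbounded JK JK T" and V: "cbounded JH JH V" and X: "cbounded JH JK X"
  shows "(isometry_op V \<and> norm T \<le> 1 \<and> right_invertible_op JK T \<longrightarrow>
            (similar_to_contraction (sum_J JK JH) (block_op T X V) \<longleftrightarrow>
              (\<exists>A F. cbounded JH JK A \<and> cbounded JH JK F \<and> X = A + F \<and>
                 (\<exists>C. \<forall>n. norm (\<Sum>j=0..n. opow T j o\<^sub>L A o\<^sub>L opow (hadj V) (j + 1)) \<le> C) \<and>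
                 F o\<^sub>L V = 0)))
       \<and> (T o\<^sub>L hadj T = id_blinfun \<and> norm V \<le> 1 \<and> left_invertible_op JH V \<longrightarrow>
            (similar_to_contraction (sum_J JK JH) (block_op T X V) \<longleftrightarrow>
              (\<exists>A F. cbounded JH JK A \<and> cbounded JH JK F \<and> X = A + F \<and>
                 (\<exists>C. \<forall>n. norm (\<Sum>j=0..n. opow (hadj T) (j + 1) o\<^sub>L A o\<^sub>L opow V j) \<le> C) \<and>
                 T o\<^sub>L F = 0)))"
  (is "(_ \<longrightarrow> (?sim \<longleftrightarrow> ?condA)) \<and> (_ \<longrightarrow> (_ \<longleftrightarrow> ?condB))")
proof (intro conjI impI)
  \<comment> \<open>Shared by both parts: any real linear solution is first made complex linear,
    then used as a shear.\<close>
  have sim: ?sim if "X = (Z o\<^sub>L V) - (T o\<^sub>L Z)" "norm T \<le> 1" "norm V \<le> 1" for Z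
    using intertwined_cbounded[OF JK JH T V X that(1)] similar_to_contraction_block_op[OF _ _ that(2,3)] by blast
  {
    assume asm: "isometry_op V \<and> norm T \<le> 1 \<and> right_invertible_op JK T"
    then have VV: "hadj V o\<^sub>L V = id_blinfun" and T1: "norm T \<le> 1" and V1: "norm V \<le> 1"
      by (auto simp: isometry_op_iff_hadj[symmetric] norm_isometry_op_le_1)
    show "?sim \<longleftrightarrow> ?condA"
    proof
      assume ?sim
      then obtain Z where Z: "cbounded JH JK Z" "X = (Z o\<^sub>L V) - (T o\<^sub>L Z)"
        using similar_isometry_imp_intertwined[OF _ VV] intertwined_cbounded[OF JK JH T V X] by metis
      \<comment> \<open>As \<open>V\<close> is an isometry, \<open>W V = Z V\<close>, so
        \<open>X - A = T (W - Z)\<close> vanishes on the range of \<open>V\<close>.\<close>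
      define W where "W = Z o\<^sub>L V o\<^sub>L hadj V"
      define A where "A = (Z o\<^sub>L V) - (T o\<^sub>L W)"
      have A: "cbounded JH JK A"
        using Z(1) T V cbounded_hadj[OF JH JH V]
        by (simp add: A_def W_def cbounded_iff blinfun.diff_left blinfun.diff_right)
      show ?condA
      proof (intro exI conjI allI)
        show "cbounded JH JK A" "cbounded JH JK (X - A)" by (intro cbounded_diff A X)+
        show "X = A + (X - A)" by simp
        show "norm (\<Sum>j=0..n. opow T j o\<^sub>L A o\<^sub>L opow (hadj V) (j + 1)) \<le> 2 * norm W" for n
          unfolding A_def W_def by (rule bounded_sum_hadj_right[OF T1 V1])
        show "(X - A) o\<^sub>L V = 0"
          using blinfun_compose_applyD[OF VV]
          by (intro blinfun_eqI) (simp add: Z(2) A_def W_def blinfun.diff_left)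
      qed
    next
      assume ?condA
      then obtain A F C where AF: "X = A + F" "F o\<^sub>L V = 0"
        and C: "\<And>n. norm (\<Sum>j=0..n. opow T j o\<^sub>L A o\<^sub>L opow (hadj V) (j + 1)) \<le> C" by blast
      obtain S where "T o\<^sub>L S = id_blinfun" using asm by (auto simp: right_invertible_op_def)
      from bounded_sum_imp_intertwined_isometry[OF VV this C AF(2)] obtain Z where "A + F = (Z o\<^sub>L V) - (T o\<^sub>L Z)" by blast
      then show ?sim using sim[OF _ T1 V1] AF(1) by blast
    qed
  next
    assume asm: "T o\<^sub>L hadj T = id_blinfun \<and> norm V \<le> 1 \<and> left_invertible_op JH V"
    then have TT: "T o\<^sub>L hadj T = id_blinfun" and V1: "norm V \<le> 1" by auto
    have "isometry_op (hadj T)" using TT by (simp add: isometry_op_iff_hadj hadj_hadj)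
    then have T1: "norm T \<le> 1" by (rule norm_le_if_norm_hadj_le[OF norm_isometry_op_le_1])
    show "?sim \<longleftrightarrow> ?condB"
    proof
      assume ?sim
      then obtain Z where Z: "cbounded JH JK Z" "X = (Z o\<^sub>L V) - (T o\<^sub>L Z)"
        using similar_coisometry_imp_intertwined[OF _ TT] intertwined_cbounded[OF JK JH T V X] by metis
      \<comment> \<open>As \<open>T\<close> is a coisometry, \<open>T W = T Z\<close>, so
        \<open>T\<close> annihilates \<open>X - A = (Z - W) V\<close>.\<close>
      define W where "W = hadj T o\<^sub>L T o\<^sub>L Z"
      define A where "A = (W o\<^sub>L V) - (T o\<^sub>L Z)"
      have A: "cbounded JH JK A"
        using Z(1) T V cbounded_hadj[OF JK JK T]
        by (simp add: A_def W_def cbounded_iff blinfun.diff_left blinfun.diff_right)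
      show ?condB
      proof (intro exI conjI allI)
        show "cbounded JH JK A" "cbounded JH JK (X - A)" by (intro cbounded_diff A X)+
        show "X = A + (X - A)" by simp
        show "norm (\<Sum>j=0..n. opow (hadj T) (j + 1) o\<^sub>L A o\<^sub>L opow V j) \<le> 2 * norm W" for n
          unfolding A_def W_def by (rule bounded_sum_hadj_left[OF T1 V1])
        show "T o\<^sub>L (X - A) = 0"
          using blinfun_compose_applyD[OF TT]
          by (intro blinfun_eqI) (simp add: Z(2) A_def W_def blinfun.diff_left blinfun.diff_right)
      qed
    next
      assume ?condB
      then obtain A F C where AF: "X = A + F" "T o\<^sub>L F = 0"
        and C: "\<And>n. norm (\<Sum>j=0..n. opow (hadj T) (j + 1) o\<^sub>L A o\<^sub>L opow V j) \<le> C" by blast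
      obtain S where "S o\<^sub>L V = id_blinfun" using asm by (auto simp: left_invertible_op_def)
      from bounded_sum_imp_intertwined_coisometry[OF TT this C AF(2)] obtain Z where "A + F = (Z o\<^sub>L V) - (T o\<^sub>L Z)" by blast
      then show ?sim using sim[OF _ T1 V1] AF(1) by blast
    qed
  }
qed

end
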